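(* Let $A\in\mathbb{R}^{m\times n}$, $b\in\mathbb{R}^m$, $\lambda>0$, let $\bar x\in\mathbb{R}^n$ be a minimizer of $\min_{x\in\mathbb{R}^n}\|Ax-b\|+\lambda\|x\|_1$, and let $I:=\operatorname{supp}(\bar x)$. Suppose that (i) $\ker A_I=\{0\}$ and $b\notin\operatorname{rge}A_I$; (ii) $\|A_{I^C}^{\top}(b-A\bar x)\|_\infty<\lambda\|A\bar x-b\|$. Then $A\bar x\neq b$ and, for $J:=\left\{i\in\{1,\dots,n\}:\left|A_i^{\top}\frac{b-A\bar x}{\|A\bar x-b\|}\right|=\lambda\right\}$, we have $\ker A_J=\{0\}$ and $b\notin\operatorname{rge}A_J$.
   Context: $\|\cdot\|$ is the Euclidean norm, $\|x\|_1=\sum_i|x_i|$, $\|x\|_\infty=\max_i|x_i|$ (equal to $0$ for the empty vector). $\operatorname{supp}(x)=\{i: x_i\ne0\}$. For $K\subseteq\{1,\dots,n\}$, $A_K$ is the $m\times|K|$ matrix formed by the columns $A_i$ of $A$ with $i\in K$ (for $K=\emptyset$: $\ker A_\emptyset=\{0\}$, $\operatorname{rge}A_\emptyset=\{0\}$), and $K^C=\{1,\dots,n\}\setminus K$. $\operatorname{rge}$ denotes the range. *)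

theory Defs
  imports "HOL-Analysis.Analysis"
begin

definition l1_norm :: "real^'n \<Rightarrow> real" where
  "l1_norm x = (\<Sum>i\<in>UNIV. \<bar>x $ i\<bar>)"

definition supp :: "real^'n \<Rightarrow> 'n set" where
  "supp x = {i. x $ i \<noteq> 0}"

text \<open>
  For an index set \<open>K\<close>, a vector with entries indexed by \<open>K\<close> (an element of the space of
  dimension \<open>card K\<close>) is a function in \<open>extensional K\<close>, i.e. one that is \<open>undefined\<close> outside \<open>K\<close>.
  For \<open>K = {}\<close> this space has exactly one element, its zero vector.
\<close>

definition zero_vec_on :: "'n set \<Rightarrow> 'n \<Rightarrow> real" where
  "zero_vec_on K = (\<lambda>i\<in>K. 0)"

definition linf_norm_on :: "'n::finite set \<Rightarrow> ('n \<Rightarrow> real) \<Rightarrow> real" where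
  "linf_norm_on K v = (if K = {} then 0 else Max ((\<lambda>i. \<bar>v i\<bar>) ` K))"

text \<open>
  The matrix \<open>A\<^sub>K\<close> formed by the columns of \<open>A\<close> with index in \<open>K\<close> enters through its products:
  \<open>cols_mult A K v\<close> is \<open>A\<^sub>K v\<close>, and \<open>cols_transpose_mult A K y\<close> is \<open>A\<^sub>K\<^sup>T y\<close>.
\<close>

definition cols_mult :: "real^'n^'m \<Rightarrow> 'n set \<Rightarrow> ('n \<Rightarrow> real) \<Rightarrow> real^'m" where
  "cols_mult A K v = (\<Sum>i\<in>K. v i *\<^sub>R column i A)"

definition cols_transpose_mult :: "real^'n^'m \<Rightarrow> 'n set \<Rightarrow> real^'m \<Rightarrow> ('n \<Rightarrow> real)" where
  "cols_transpose_mult A K y = (\<lambda>i\<in>K. column i A \<bullet> y)"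

definition ker_cols :: "real^'n^'m \<Rightarrow> 'n set \<Rightarrow> ('n \<Rightarrow> real) set" where
  "ker_cols A K = {v \<in> extensional K. cols_mult A K v = 0}"

definition rge_cols :: "real^'n^'m \<Rightarrow> 'n set \<Rightarrow> (real^'m) set" where
  "rge_cols A K = cols_mult A K ` extensional K"

end

theory Submission
  imports Defs
begin

text \<open>
  The index set \<open>J\<close> equals the support of the minimizer \<open>xbar\<close>, so the conclusion is hypothesis (i).
  For \<open>i\<close> in the support, the objective is differentiable in the \<open>i\<close>-th coordinate at \<open>xbar\<close>
  (the residual is nonzero because \<open>A xbar\<close> lies in the range of the support columns), and the
  vanishing of this partial derivative gives \<open>i \<in> J\<close>; off the support, hypothesis (ii) excludes
  equality.
\<close>

lemma matrix_vector_mult_in_rge_cols: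
  "A *v x \<in> rge_cols A (supp x)"
proof -
  have "A *v x = (\<Sum>i\<in>supp x. x $ i *\<^sub>R column i A)"
    by (auto simp: matrix_mult_sum scalar_mult_eq_scaleR supp_def intro!: sum.mono_neutral_right)
  also have "\<dots> = cols_mult A (supp x) (restrict (($) x) (supp x))"
    by (simp add: cols_mult_def)
  finally show ?thesis
    unfolding rge_cols_def by blast
qed

lemma abs_cols_transpose_mult_le_linf:
  assumes "i \<in> K"
  shows "\<bar>column i A \<bullet> y\<bar> \<le> linf_norm_on K (cols_transpose_mult A K y)"
proof -
  have "\<bar>cols_transpose_mult A K y i\<bar> \<le> Max ((\<lambda>i. \<bar>cols_transpose_mult A K y i\<bar>) ` K)"
    using assms by (intro Max_ge) auto
  then show ?thesis
    using assms by (auto simp: linf_norm_on_def cols_transpose_mult_def)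
qed

text \<open>Moving along one coordinate axis changes a single summand, so the remaining sum is
  constant in \<open>t\<close> and drops out when values on the line are compared.\<close>

lemma l1_norm_add_axis:
  "l1_norm (x + t *\<^sub>R axis i 1) = \<bar>x $ i + t\<bar> + (\<Sum>j\<in>UNIV - {i}. \<bar>x $ j\<bar>)"
proof -
  have "(\<Sum>j\<in>UNIV - {i}. \<bar>(x + t *\<^sub>R axis i 1) $ j\<bar>) = (\<Sum>j\<in>UNIV - {i}. \<bar>x $ j\<bar>)"
    by (intro sum.cong) (auto simp: axis_def)
  then show ?thesis
    by (simp add: l1_norm_def sum.remove[of UNIV i])
qed

text \<open>Chain rule with the gradient \<open>sgn r\<close> of the norm at \<open>r\<close>. The
  type is kept general so that the result serves both the residual in \<open>real^'m\<close> and, on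
  the reals, the absolute value.\<close>

lemma has_real_derivative_norm_line:
  fixes r v :: "'a::real_inner"
  assumes "r \<noteq> 0"
  shows "((\<lambda>t. norm (r + t *\<^sub>R v)) has_real_derivative v \<bullet> sgn r) (at 0)"
proof -
  have "((\<lambda>t. r + t *\<^sub>R v) has_derivative (\<lambda>t. t *\<^sub>R v)) (at 0)"
    by (auto intro!: derivative_eq_intros)
  moreover have "(norm has_derivative (\<lambda>h. h \<bullet> sgn r)) (at (r + 0 *\<^sub>R v))"
    using has_derivative_norm[OF assms] by simp
  ultimately have "((\<lambda>t. norm (r + t *\<^sub>R v)) has_derivative (\<lambda>t. (t *\<^sub>R v) \<bullet> sgn r)) (at 0)"
    by (rule has_derivative_compose)
  then show ?thesis
    by (rule has_derivative_imp_has_field_derivative) simp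
qed

text \<open>Fermat's rule on the line through \<open>x\<close> in direction \<open>axis i 1\<close>:
  both nonsmooth terms are differentiable at \<open>t = 0\<close> because \<open>A *v x - b\<close>
  and \<open>x $ i\<close> are nonzero.\<close>

lemma minimizer_stationary_on_supp:
  fixes A :: "real^'n^'m"
  assumes min: "\<And>y. norm (A *v x - b) + lam * l1_norm x \<le> norm (A *v y - b) + lam * l1_norm y"
    and "A *v x \<noteq> b" and "i \<in> supp x"
  shows "column i A \<bullet> sgn (A *v x - b) + lam * sgn (x $ i) = 0"
proof -
  define r where "r = A *v x - b"
  define \<phi> where "\<phi> = (\<lambda>t. norm (r + t *\<^sub>R column i A) + lam * \<bar>x $ i + t\<bar>)"
  have "r \<noteq> 0" "x $ i \<noteq> 0"
    using assms by (auto simp: r_def supp_def)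
  have \<phi>: "norm (A *v (x + t *\<^sub>R axis i 1) - b) + lam * l1_norm (x + t *\<^sub>R axis i 1)
      = \<phi> t + lam * (\<Sum>j\<in>UNIV - {i}. \<bar>x $ j\<bar>)" for t
    by (simp add: \<phi>_def r_def l1_norm_add_axis matrix_vector_right_distrib
        matrix_vector_mult_scaleR matrix_vector_mult_basis algebra_simps)
  have le: "\<phi> 0 \<le> \<phi> t" for t
    using min[of "x + t *\<^sub>R axis i 1"] \<phi>[of 0] \<phi>[of t] by simp
  have "((\<lambda>t. norm (r + t *\<^sub>R column i A)) has_real_derivative column i A \<bullet> sgn r) (at 0)"
    using \<open>r \<noteq> 0\<close> by (rule has_real_derivative_norm_line)
  \<comment> \<open>On the reals the norm is the absolute value; the direction is
    \<open>1\<close>.\<close>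
  moreover have "((\<lambda>t. \<bar>x $ i + t\<bar>) has_real_derivative sgn (x $ i)) (at 0)"
    using has_real_derivative_norm_line[OF \<open>x $ i \<noteq> 0\<close>, of 1] by simp
  ultimately have "(\<phi> has_real_derivative column i A \<bullet> sgn r + lam * sgn (x $ i)) (at 0)"
    unfolding \<phi>_def by (intro DERIV_add DERIV_cmult)
  \<comment> \<open>The minimum of \<open>\<phi>\<close> at 0 is global, so the radius 1 is an
    arbitrary choice.\<close>
  from DERIV_local_min[OF this zero_less_one] le show ?thesis
    by (simp add: r_def)
qed

theorem proposition3p10:
  fixes A :: "real^'n^'m" and b :: "real^'m" and lam :: real and xbar :: "real^'n"
  assumes "lam > 0"
    and "is_arg_min (\<lambda>x. norm (A *v x - b) + lam * l1_norm x) (\<lambda>x. x \<in> UNIV) xbar"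
    and "ker_cols A (supp xbar) = {zero_vec_on (supp xbar)}"
    and "b \<notin> rge_cols A (supp xbar)"
    and "linf_norm_on (- supp xbar) (cols_transpose_mult A (- supp xbar) (b - A *v xbar))
           < lam * norm (A *v xbar - b)"
  shows "A *v xbar \<noteq> b \<and>
    (let J = {i. \<bar>column i A \<bullet> ((b - A *v xbar) /\<^sub>R norm (A *v xbar - b))\<bar> = lam}
     in ker_cols A J = {zero_vec_on J} \<and> b \<notin> rge_cols A J)"
proof -
  define r where "r = A *v xbar - b"
  have "A *v xbar \<noteq> b"
    using matrix_vector_mult_in_rge_cols[of A xbar] assms(4) by auto
  then have "norm r > 0"
    by (simp add: r_def)
  \<comment> \<open>The vector in the definition of \<open>J\<close> is the negative of the
    normalized residual \<open>sgn r\<close>; the absolute value hides the sign.\<close>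
  have corr: "\<bar>column i A \<bullet> ((b - A *v xbar) /\<^sub>R norm (A *v xbar - b))\<bar> = \<bar>column i A \<bullet> sgn r\<bar>" for i
  proof -
    have "(b - A *v xbar) /\<^sub>R norm (A *v xbar - b) = - sgn r"
      by (simp add: r_def sgn_div_norm flip: scaleR_minus_right)
    then show ?thesis
      by (metis abs_minus_cancel inner_minus_right)
  qed
  have "\<bar>column i A \<bullet> sgn r\<bar> = lam \<longleftrightarrow> i \<in> supp xbar" for i
  proof (cases "i \<in> supp xbar")
    case True
    have "column i A \<bullet> sgn r + lam * sgn (xbar $ i) = 0"
      unfolding r_def using assms(2) \<open>A *v xbar \<noteq> b\<close> True
      by (intro minimizer_stationary_on_supp) (auto simp: is_arg_min_def not_less)
    then have "\<bar>column i A \<bullet> sgn r\<bar> = \<bar>lam * sgn (xbar $ i)\<bar>"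
      by linarith
    also have "\<dots> = lam"
      using assms(1) True by (simp add: abs_mult supp_def abs_sgn_eq)
    finally show ?thesis
      using True by simp
  next
    case False
    have "\<bar>column i A \<bullet> (b - A *v xbar)\<bar> < lam * norm r"
      using abs_cols_transpose_mult_le_linf[of i "- supp xbar" A "b - A *v xbar"] assms(5) False
      by (simp add: r_def)
    \<comment> \<open>Dividing by \<open>norm r > 0\<close> keeps the inequality strict, which rules
      out membership in \<open>J\<close>.\<close>
    then have "\<bar>column i A \<bullet> sgn r\<bar> < lam"
      unfolding corr[symmetric] inner_scaleR_right using \<open>norm r > 0\<close>
      by (simp add: r_def abs_mult pos_divide_less_eq flip: divide_inverse_commute)
    then show ?thesis
      using False by simp
  qed
  then have "{i. \<bar>column i A \<bullet> ((b - A *v xbar) /\<^sub>R norm (A *v xbar - b))\<bar> = lam} = supp xbar"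
    unfolding corr by auto
  then show ?thesis
    using \<open>A *v xbar \<noteq> b\<close> assms(3,4) by (simp add: Let_def)
qed

end
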